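(* For odd $k$ let $\mathrm{Ex}^{(k+1)/2}_k=f_{\{(k+1)/2\},k}:\{-1,1\}^k\to\{0,1\}$ be the function which is $1$ exactly on vectors with exactly $\frac{k+1}2$ coordinates equal to $1$, and let $\rho\big(\mathrm{Ex}^{(k+1)/2}_k\big)=\Pr_{\mathbf b\sim\mathrm{Unif}(\{-1,1\}^k)}\big[\mathrm{Ex}^{(k+1)/2}_k(\mathbf b)=1\big]$. Then, with the limit taken over odd $k$, $$\lim_{k\text{ odd},\,k\to\infty}\frac{\alpha\big(\mathrm{Ex}^{(k+1)/2}_k\big)}{\rho\big(\mathrm{Ex}^{(k+1)/2}_k\big)}=1.$$
   Context: For $\mathbf b\in\{-1,1\}^k$, $\mathrm{wt}(\mathbf b)$ is the number of coordinates equal to $1$. For nonempty $S\subseteq[k]=\{1,\dots,k\}$, $f_{S,k}:\{-1,1\}^k\to\{0,1\}$ is given by $f_{S,k}(\mathbf x)=1$ iff $\mathrm{wt}(\mathbf x)\in S$. $\Delta_k$ is the set of symmetric probability distributions $\mathcal D$ on $\{-1,1\}^k$ (vectors of equal weight are equiprobable). $\mathrm{Bern}(p)$ is the random variable equal to $1$ with probability $p$ and $-1$ with probability $1-p$; $\odot$ is the coordinatewise product. For $\mathcal D\in\Delta_k$ and $p\in[0,1]$ define $$\lambda_S(\mathcal D,p)=\mathbb E_{\mathbf a\sim\mathcal D,\ \mathbf b\sim \mathrm{Bern}(p)^k}[f_{S,k}(\mathbf a\odot\mathbf b)],\quad \mu(\mathcal D)=\mathbb E_{\mathbf b\sim\mathcal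 D}[b_1],\quad \beta_S(\mathcal D)=\sup_{p\in[0,1]}\lambda_S(\mathcal D,p),\quad \gamma_S(\mathcal D)=\lambda_S(\mathcal D,1).$$ The (sketching approximation) ratio of $f_{S,k}$ is $$\alpha(f_{S,k})=\inf_{\mathcal D_N,\mathcal D_Y\in\Delta_k:\ \mu(\mathcal D_N)=\mu(\mathcal D_Y)}\frac{\beta_S(\mathcal D_N)}{\gamma_S(\mathcal D_Y)},$$ where the ratio is $+\infty$ if $\gamma_S(\mathcal D_Y)=0$. *)

theory Defs
  imports "HOL-Probability.Probability" "HOL-Probability.Product_PMF"
begin

text \<open>A vector in \<open>{-1,1}^k\<close> is an extensional function on \<open>{1..k}\<close>
  (it is \<open>undefined\<close> outside \<open>{1..k}\<close>), so that the cube is finite.\<close>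

definition cube :: "nat \<Rightarrow> (nat \<Rightarrow> real) set" where
  "cube k = {1..k} \<rightarrow>\<^sub>E {-1, 1}"

definition wt :: "nat \<Rightarrow> (nat \<Rightarrow> real) \<Rightarrow> nat" where
  "wt k b = card {i \<in> {1..k}. b i = 1}"

definition sym_pred :: "nat set \<Rightarrow> nat \<Rightarrow> (nat \<Rightarrow> real) \<Rightarrow> real" where
  "sym_pred S k x = (if wt k x \<in> S then 1 else 0)"

definition sym_dists :: "nat \<Rightarrow> (nat \<Rightarrow> real) pmf set" where
  "sym_dists k = {D. set_pmf D \<subseteq> cube k \<and>
     (\<forall>a\<in>cube k. \<forall>b\<in>cube k. wt k a = wt k b \<longrightarrow> pmf D a = pmf D b)}"

definition bern :: "real \<Rightarrow> real pmf" where
  "bern p = map_pmf (\<lambda>c. if c then 1 else -1) (bernoulli_pmf p)"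

text \<open>The default value \<open>undefined\<close> makes the samples extensional, i.e. elements of \<open>cube k\<close>.\<close>

definition bern_vec :: "nat \<Rightarrow> real \<Rightarrow> (nat \<Rightarrow> real) pmf" where
  "bern_vec k p = Pi_pmf {1..k} undefined (\<lambda>_. bern p)"

definition coord_prod :: "nat \<Rightarrow> (nat \<Rightarrow> real) \<Rightarrow> (nat \<Rightarrow> real) \<Rightarrow> nat \<Rightarrow> real" where
  "coord_prod k a b = (\<lambda>i\<in>{1..k}. a i * b i)"

definition lam :: "nat set \<Rightarrow> nat \<Rightarrow> (nat \<Rightarrow> real) pmf \<Rightarrow> real \<Rightarrow> real" where
  "lam S k D p = measure_pmf.expectation (pair_pmf D (bern_vec k p))
     (\<lambda>(a, b). sym_pred S k (coord_prod k a b))"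

definition mu :: "(nat \<Rightarrow> real) pmf \<Rightarrow> real" where
  "mu D = measure_pmf.expectation D (\<lambda>b. b 1)"

definition beta :: "nat set \<Rightarrow> nat \<Rightarrow> (nat \<Rightarrow> real) pmf \<Rightarrow> real" where
  "beta S k D = (SUP p\<in>{0..1}. lam S k D p)"

definition gamma :: "nat set \<Rightarrow> nat \<Rightarrow> (nat \<Rightarrow> real) pmf \<Rightarrow> real" where
  "gamma S k D = lam S k D 1"

text \<open>The case distinction is needed because \<open>0 / 0 = 0\<close> in \<^typ>\<open>ereal\<close>.\<close>

definition dist_ratio ::
    "nat set \<Rightarrow> nat \<Rightarrow> (nat \<Rightarrow> real) pmf \<Rightarrow> (nat \<Rightarrow> real) pmf \<Rightarrow> ereal" where
  "dist_ratio S k DN DY =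
     (if gamma S k DY = 0 then \<infinity> else ereal (beta S k DN / gamma S k DY))"

definition alpha :: "nat set \<Rightarrow> nat \<Rightarrow> ereal" where
  "alpha S k = Inf {dist_ratio S k DN DY | DN DY.
     DN \<in> sym_dists k \<and> DY \<in> sym_dists k \<and> mu DN = mu DY}"

definition rho :: "nat \<Rightarrow> ((nat \<Rightarrow> real) \<Rightarrow> real) \<Rightarrow> real" where
  "rho k f = measure_pmf.prob (pmf_of_set (cube k)) {b. f b = 1}"

end

theory Submission
  imports Defs
begin

text \<open>Put \<open>s = (k + 1) / 2\<close>. At \<open>p = 1/2\<close> the vector \<open>a \<odot> b\<close> is uniform whatever \<open>a\<close> is, so
  \<open>\<beta> \<ge> \<rho>\<close>; as \<open>\<gamma> \<le> 1\<close>, this gives \<open>\<alpha> \<ge> \<rho>\<close>. Conversely, take \<open>D\<^sub>N\<close> uniform, so that \<open>\<beta> = \<rho>\<close>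
  and \<open>\<mu> = 0\<close>. The uniform distribution on the vectors of weight \<open>s\<close> has mean only \<open>1/k\<close>, so
  mixing in the all \<open>-1\<close> vector with probability \<open>1/(k + 1)\<close> produces a \<open>D\<^sub>Y\<close> with \<open>\<mu> = 0\<close> and
  \<open>\<gamma> = k/(k + 1)\<close>. Hence \<open>1 \<le> \<alpha>/\<rho> \<le> 1 + 1/k\<close>.\<close>

section \<open>The cube and multiplication by sign vectors\<close>

lemma finite_cube [simp]: "finite (cube k)"
  by (simp add: cube_def finite_PiE)

lemma cube_ne [simp]: "cube k \<noteq> {}"
  by (simp add: cube_def PiE_eq_empty_iff)

lemma cube_PiE_dflt: "cube k = PiE_dflt {1..k} undefined (\<lambda>_. {-1, 1})"
  by (auto simp: cube_def PiE_dflt_def PiE_def extensional_def)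

lemma coord_prod_cube: "a \<in> cube k \<Longrightarrow> b \<in> cube k \<Longrightarrow> coord_prod k a b \<in> cube k"
  by (fastforce simp: cube_def coord_prod_def PiE_iff)

lemma coord_prod_commute: "coord_prod k a b = coord_prod k b a"
  by (simp add: coord_prod_def mult.commute)

lemma coord_prod_involution:
  assumes "a \<in> cube k" "b \<in> cube k"
  shows "coord_prod k a (coord_prod k a b) = b"
proof
  fix i
  show "coord_prod k a (coord_prod k a b) i = b i"
  proof (cases "i \<in> {1..k}")
    case True
    then have "a i = -1 \<or> a i = 1" using assms by (auto simp: cube_def PiE_iff)
    with True show ?thesis by (auto simp: coord_prod_def)
  next
    case False
    then show ?thesis using assms by (auto simp: coord_prod_def cube_def PiE_def extensional_def)
  qed
qed

text \<open>Multiplication by a fixed sign vector is its own inverse, hence permutes the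
  cube.\<close>

lemma map_coord_prod_uniform:
  assumes "a \<in> cube k"
  shows "map_pmf (coord_prod k a) (pmf_of_set (cube k)) = pmf_of_set (cube k)"
proof (rule map_pmf_of_set_bij_betw)
  show "bij_betw (coord_prod k a) (cube k) (cube k)"
    using assms by (intro bij_betw_byWitness[where f' = "coord_prod k a"])
      (auto simp: coord_prod_involution coord_prod_cube)
qed auto

text \<open>Conditionally on \<open>a\<close> the product is uniform, so the law of \<open>a\<close>
  is forgotten. Below, \<open>D\<close> is once the given distribution and once the noise
  \<open>bern_vec k p\<close>.\<close>

lemma map_coord_prod_pair_uniform:
  assumes "set_pmf D \<subseteq> cube k"
  shows "map_pmf (\<lambda>(a, b). coord_prod k a b) (pair_pmf D (pmf_of_set (cube k))) =
    pmf_of_set (cube k)"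
proof -
  have "map_pmf (\<lambda>(a, b). coord_prod k a b) (pair_pmf D (pmf_of_set (cube k))) =
    bind_pmf D (\<lambda>a. map_pmf (coord_prod k a) (pmf_of_set (cube k)))"
    by (simp add: pair_pmf_def map_bind_pmf map_pmf_def bind_assoc_pmf bind_return_pmf)
  also have "\<dots> = bind_pmf D (\<lambda>_. pmf_of_set (cube k))"
    using assms by (intro bind_pmf_cong) (auto intro!: map_coord_prod_uniform)
  finally show ?thesis by simp
qed

section \<open>Noise at p = 1/2 and uniform inputs\<close>

lemma lam_map:
  "lam S k D p = measure_pmf.expectation
     (map_pmf (\<lambda>(a, b). coord_prod k a b) (pair_pmf D (bern_vec k p))) (sym_pred S k)"
  by (simp add: lam_def case_prod_unfold)

lemma bern_half: "bern (1/2) = pmf_of_set {-1, 1}"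
proof -
  have "bern (1/2) = map_pmf (\<lambda>c. if c then 1 else -1) (pmf_of_set UNIV)"
    by (simp add: bern_def bernoulli_pmf_half_conv_pmf_of_set)
  also have "\<dots> = pmf_of_set ((\<lambda>c. if c then 1 else -1) ` UNIV)"
    by (intro map_pmf_of_set_inj) (auto simp: inj_on_def)
  also have "(\<lambda>c. if c then 1 else -1 :: real) ` UNIV = {-1, 1}"
    by (auto simp: UNIV_bool)
  finally show ?thesis .
qed

lemma bern_vec_half: "bern_vec k (1/2) = pmf_of_set (cube k)"
  unfolding bern_vec_def bern_half cube_PiE_dflt by (rule Pi_pmf_of_set) auto

lemma bern_vec_support: "set_pmf (bern_vec k p) \<subseteq> cube k"
proof -
  have "set_pmf (bern_vec k p) \<subseteq> PiE_dflt {1..k} undefined (\<lambda>_. set_pmf (bern p))"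
    unfolding bern_vec_def using set_Pi_pmf_subset'[of "{1..k}" undefined "\<lambda>_. bern p"] by (simp add: o_def)
  also have "\<dots> \<subseteq> cube k"
    by (auto simp: cube_PiE_dflt PiE_dflt_def bern_def split: if_splits)
  finally show ?thesis .
qed

lemma rho_eq_expectation:
  "rho k (sym_pred S k) = measure_pmf.expectation (pmf_of_set (cube k)) (sym_pred S k)"
proof -
  have "measure_pmf.expectation M (sym_pred S k) =
    measure_pmf.expectation M (indicator {b. sym_pred S k b = 1})" for M
    by (intro Bochner_Integration.integral_cong) (auto simp: sym_pred_def indicator_def)
  then show ?thesis by (simp add: rho_def)
qed

lemma lam_half:
  assumes "set_pmf D \<subseteq> cube k"
  shows "lam S k D (1/2) = rho k (sym_pred S k)"
  by (simp only: lam_map bern_vec_half map_coord_prod_pair_uniform[OF assms] rho_eq_expectation)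

text \<open>The product is commutative, so a uniform input can play the part of the uniform noise.
  As the value is constant in \<open>p\<close>, it is also the supremum \<open>beta\<close>.\<close>

lemma lam_uniform: "lam S k (pmf_of_set (cube k)) p = rho k (sym_pred S k)"
proof -
  have "map_pmf (\<lambda>(a, b). coord_prod k a b) (pair_pmf (pmf_of_set (cube k)) (bern_vec k p)) =
    map_pmf (\<lambda>(a, b). coord_prod k a b) (pair_pmf (bern_vec k p) (pmf_of_set (cube k)))"
    by (subst pair_commute_pmf)
      (simp add: pmf.map_comp o_def case_prod_unfold coord_prod_commute)
  then show ?thesis
    by (simp only: lam_map map_coord_prod_pair_uniform[OF bern_vec_support] rho_eq_expectation)
qed

section \<open>Bounds and formulas for \<open>beta\<close> and \<open>gamma\<close>\<close>

lemma sym_pred_bounds: "0 \<le> sym_pred S k x" "sym_pred S k x \<le> 1"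
  by (auto simp: sym_pred_def)

lemma expectation_sym_pred_bounds:
  "0 \<le> measure_pmf.expectation M (sym_pred S k)" "measure_pmf.expectation M (sym_pred S k) \<le> 1"
proof -
  have "integrable (measure_pmf M) (sym_pred S k)"
    by (intro measure_pmf.integrable_const_bound[where B = 1]) (auto simp: sym_pred_def)
  then show "measure_pmf.expectation M (sym_pred S k) \<le> 1"
    by (intro measure_pmf.integral_le_const) (auto simp: sym_pred_bounds)
qed (simp add: sym_pred_bounds)

lemma lam_bounds: "0 \<le> lam S k D p" "lam S k D p \<le> 1"
  unfolding lam_map by (rule expectation_sym_pred_bounds)+

lemma beta_ge_rho:
  assumes "set_pmf D \<subseteq> cube k"
  shows "rho k (sym_pred S k) \<le> beta S k D"
  unfolding beta_def lam_half[OF assms, symmetric]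
  \<comment> \<open>A real supremum dominates its members only for a set bounded above; here 1 is a
    bound.\<close>
  by (rule cSUP_upper) (auto intro!: bdd_aboveI2[where M = 1] lam_bounds)

lemma beta_uniform: "beta S k (pmf_of_set (cube k)) = rho k (sym_pred S k)"
  by (simp add: beta_def lam_uniform)

text \<open>At p = 1 the noise is the all-ones vector, which leaves every input unchanged.\<close>

lemma gamma_eq_expectation:
  assumes "set_pmf D \<subseteq> cube k"
  shows "gamma S k D = measure_pmf.expectation D (sym_pred S k)"
proof -
  \<comment> \<open>Outside \<open>{1..k}\<close> the value has to agree with the default of
    \<open>Pi_pmf\<close> in \<open>bern_vec\<close>.\<close>
  define e :: "nat \<Rightarrow> real" where "e = (\<lambda>i. if i \<in> {1..k} then 1 else undefined)"
  have "bernoulli_pmf 1 = return_pmf True"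
    by (rule pmf_eqI) (case_tac i, auto)
  then have "bern 1 = return_pmf 1"
    by (simp add: bern_def)
  then have "bern_vec k 1 = return_pmf e"
    unfolding bern_vec_def e_def by (simp add: Pi_pmf_return_pmf)
  then have "map_pmf (\<lambda>(a, b). coord_prod k a b) (pair_pmf D (bern_vec k 1)) =
    map_pmf (\<lambda>a. coord_prod k a e) D"
    by (simp add: pair_return_pmf2 pmf.map_comp o_def)
  also have "\<dots> = map_pmf (\<lambda>a. a) D"
  proof (rule map_pmf_cong)
    fix a assume "a \<in> set_pmf D"
    with assms have "a \<in> cube k" by auto
    then show "coord_prod k a e = a"
      by (auto simp: coord_prod_def e_def cube_def PiE_def extensional_def)
  qed simp
  finally show ?thesis by (simp add: gamma_def lam_map)
qed

section \<open>The mean as an expectation over weights\<close>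

lemma sum_cube_eq_wt:
  assumes "b \<in> cube k"
  shows "(\<Sum>i\<in>{1..k}. b i) = 2 * real (wt k b) - real k"
proof -
  have "(\<Sum>i\<in>{1..k}. b i) = (\<Sum>i\<in>{1..k}. 2 * (if b i = 1 then 1 else 0) - 1)"
    using assms by (intro sum.cong) (fastforce simp: cube_def PiE_iff)+
  also have "\<dots> = 2 * (\<Sum>i\<in>{1..k}. if b i = 1 then 1 else 0) - real k"
    by (simp add: sum_subtractf sum_distrib_left)
  also have "(\<Sum>i\<in>{1..k}. if b i = 1 then 1 else 0) = real (wt k b)"
    by (simp add: wt_def sum.If_cases Int_def)
  finally show ?thesis .
qed

lemma comp_transpose_cube:
  assumes "j \<in> {1..k}" "b \<in> cube k"
  shows "b \<circ> Transposition.transpose 1 j \<in> cube k" "wt k (b \<circ> Transposition.transpose 1 j) = wt k b"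
proof -
  have mem: "Transposition.transpose 1 j i \<in> {1..k} \<longleftrightarrow> i \<in> {1..k}" for i
    using assms(1) by (auto simp: Transposition.transpose_def)
  show "b \<circ> Transposition.transpose 1 j \<in> cube k"
    using assms(2) mem by (auto simp: cube_def PiE_iff extensional_def)
  have "{i \<in> {1..k}. (b \<circ> Transposition.transpose 1 j) i = 1} =
    Transposition.transpose 1 j ` {i \<in> {1..k}. b i = 1}"
    by (simp only: set_eq_iff in_transpose_image_iff mem_Collect_eq comp_apply mem simp_thms)
  then show "wt k (b \<circ> Transposition.transpose 1 j) = wt k b"
    unfolding wt_def by (simp only: card_image[OF inj_on_transpose])
qed

lemma sym_dists_support: "D \<in> sym_dists k \<Longrightarrow> set_pmf D \<subseteq> cube k"
  unfolding sym_dists_def by blast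

text \<open>Swapping coordinates 1 and \<open>j\<close> preserves the weight, hence the mass of each
  cube point; off the cube both masses are 0.\<close>

lemma map_transpose_sym_dists:
  assumes D: "D \<in> sym_dists k" and j: "j \<in> {1..k}"
  shows "map_pmf (\<lambda>b. b \<circ> Transposition.transpose 1 j) D = D"
proof (rule pmf_eqI)
  fix b :: "nat \<Rightarrow> real"
  let ?t = "\<lambda>b::nat \<Rightarrow> real. b \<circ> Transposition.transpose 1 j"
  have inv: "?t (?t c) = c" for c by (simp add: fun_eq_iff)
  have "inj ?t" by (metis injI inv)
  \<comment> \<open>Writing \<open>b\<close> as \<open>?t (?t b)\<close> puts it in the range of the
    injection \<open>?t\<close>.\<close>
  then have "pmf (map_pmf ?t D) (?t (?t b)) = pmf D (?t b)"
    by (rule pmf_map_inj')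
  then have "pmf (map_pmf ?t D) b = pmf D (?t b)"
    by (simp only: inv)
  also have "\<dots> = pmf D b"
  proof (cases "b \<in> cube k")
    case True
    then show ?thesis
      using D comp_transpose_cube[OF j True] unfolding sym_dists_def by blast
  next
    case False
    then have "?t b \<notin> cube k" using comp_transpose_cube(1)[OF j, of "?t b"] by (simp only: inv) blast
    with False have "b \<notin> set_pmf D" "?t b \<notin> set_pmf D" using D unfolding sym_dists_def by blast+
    then show ?thesis by (simp add: set_pmf_iff)
  qed
  finally show "pmf (map_pmf ?t D) b = pmf D b" .
qed

text \<open>By swap invariance every coordinate has mean \<open>mu D\<close>, so the left side is
  the expected coordinate sum.\<close>

lemma mu_eq_expectation_wt:
  assumes D: "D \<in> sym_dists k"
  shows "real k * mu D = measure_pmf.expectation D (\<lambda>b. 2 * real (wt k b) - real k)"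
proof -
  have sub: "set_pmf D \<subseteq> cube k" using D by (rule sym_dists_support)
  then have fin: "finite (set_pmf D)" by (rule finite_subset) simp
  have "measure_pmf.expectation D (\<lambda>b. b j) = mu D" if j: "j \<in> {1..k}" for j
  proof -
    have "mu D = measure_pmf.expectation (map_pmf (\<lambda>b. b \<circ> Transposition.transpose 1 j) D) (\<lambda>b. b 1)"
      by (simp only: mu_def map_transpose_sym_dists[OF D j])
    then show ?thesis by simp
  qed
  then have "real k * mu D = (\<Sum>j\<in>{1..k}. measure_pmf.expectation D (\<lambda>b. b j))"
    by simp
  also have "\<dots> = measure_pmf.expectation D (\<lambda>b. \<Sum>j\<in>{1..k}. b j)"
    using fin by (simp add: integrable_measure_pmf_finite)
  also have "\<dots> = measure_pmf.expectation D (\<lambda>b. 2 * real (wt k b) - real k)"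
    using sub by (intro integral_cong_AE) (auto simp: AE_measure_pmf_iff sum_cube_eq_wt simp del: One_nat_def)
  finally show ?thesis .
qed

lemma uniform_sym_dists: "pmf_of_set (cube k) \<in> sym_dists k"
  by (simp add: sym_dists_def)

text \<open>Negating all coordinates preserves the uniform distribution and changes the sign of the
  mean.\<close>

lemma mu_uniform:
  assumes "k \<ge> 1"
  shows "mu (pmf_of_set (cube k)) = 0"
proof -
  define e :: "nat \<Rightarrow> real" where "e = (\<lambda>i\<in>{1..k}. -1)"
  have "e \<in> cube k" by (auto simp: e_def cube_def)
  then have "mu (pmf_of_set (cube k)) =
    measure_pmf.expectation (map_pmf (coord_prod k e) (pmf_of_set (cube k))) (\<lambda>b. b 1)"
    by (simp only: mu_def map_coord_prod_uniform)
  also have "\<dots> = - mu (pmf_of_set (cube k))"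
    using assms by (simp add: coord_prod_def e_def mu_def)
  finally show ?thesis by simp
qed

section \<open>Weight slices and the choice of \<open>D\<^sub>Y\<close>\<close>

lemma wt_slice_ne:
  assumes "s \<le> k"
  shows "{b \<in> cube k. wt k b = s} \<noteq> {}"
proof -
  define b :: "nat \<Rightarrow> real" where "b = (\<lambda>i\<in>{1..k}. if i \<le> s then 1 else -1)"
  have "{i \<in> {1..k}. b i = 1} = {1..s}" using assms by (auto simp: b_def)
  then have "wt k b = s" by (simp add: wt_def)
  moreover have "b \<in> cube k" by (auto simp: b_def cube_def)
  ultimately show ?thesis by blast
qed

lemma rho_pos:
  assumes "s \<le> k"
  shows "rho k (sym_pred {s} k) > 0"
proof -
  have "set_pmf (pmf_of_set (cube k)) \<inter> {b. sym_pred {s} k b = 1} \<noteq> {}"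
    using wt_slice_ne[OF assms] by (auto simp: sym_pred_def)
  then show ?thesis
    by (simp add: rho_def zero_less_measure_iff measure_pmf_zero_iff)
qed

lemma slice_sym_dists:
  assumes "s \<le> k"
  shows "pmf_of_set {b \<in> cube k. wt k b = s} \<in> sym_dists k"
  using wt_slice_ne[OF assms] by (auto simp: sym_dists_def pmf_of_set indicator_def)

lemma bind_sym_dists:
  assumes "\<And>c. D c \<in> sym_dists k"
  shows "bind_pmf M D \<in> sym_dists k"
  unfolding sym_dists_def
proof (intro CollectI conjI ballI impI)
  show "set_pmf (bind_pmf M D) \<subseteq> cube k"
    using assms sym_dists_support by fastforce
next
  fix a b assume "a \<in> cube k" "b \<in> cube k" "wt k a = wt k b"
  with assms have "pmf (D c) a = pmf (D c) b" for c
    unfolding sym_dists_def by blast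
  then show "pmf (bind_pmf M D) a = pmf (bind_pmf M D) b"
    by (simp add: pmf_bind)
qed

lemma exists_large_gamma:
  assumes k: "k = 2 * m + 1"
  shows "\<exists>D\<in>sym_dists k. mu D = 0 \<and> gamma {m + 1} k D = real k / real (k + 1)"
proof -
  define s where "s = m + 1"
  \<comment> \<open>The coordinate sums at weights \<open>s\<close> and 0 are 1 and -k, and
    \<open>q\<close> solves q - (1 - q) k = 0.\<close>
  define q where "q = real k / real (k + 1)"
  have q: "0 \<le> q" "q \<le> 1" by (auto simp: q_def)
  have sk: "s \<le> k" using k by (simp add: s_def)
  \<comment> \<open>The slice of weight 0 is just the all -1 vector, so both components of the
    mixture are uniform on a slice.\<close>
  define W where "W = (\<lambda>c. if c then s else 0)"
  define P where "P = (\<lambda>c. pmf_of_set {b \<in> cube k. wt k b = W c})"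
  define D where "D = bind_pmf (bernoulli_pmf q) P"
  have P: "P c \<in> sym_dists k" for c
    unfolding P_def W_def using sk by (intro slice_sym_dists) auto
  have D: "D \<in> sym_dists k"
    unfolding D_def using P by (rule bind_sym_dists)
  have ne: "{b \<in> cube k. wt k b = W c} \<noteq> {}" for c
    using sk by (intro wt_slice_ne) (auto simp: W_def)
  have EP: "measure_pmf.expectation (P c) (\<lambda>b. g (wt k b)) = g (W c)" for c and g :: "nat \<Rightarrow> real"
  proof -
    have "measure_pmf.expectation (P c) (\<lambda>b. g (wt k b)) =
      measure_pmf.expectation (P c) (\<lambda>b. g (W c))"
      using ne[of c] by (intro integral_cong_AE) (auto simp: AE_measure_pmf_iff P_def)
    then show ?thesis by simp
  qed
  \<comment> \<open>Mean and \<open>gamma\<close> are both expectations of functions of the weight;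
    this formula yields both.\<close>
  have E: "measure_pmf.expectation D (\<lambda>b. g (wt k b)) = q * g s + (1 - q) * g 0"
    for g :: "nat \<Rightarrow> real"
  proof -
    have "finite (set_pmf (P c))" for c
      using ne[of c] by (simp add: P_def)
    then have "measure_pmf.expectation D (\<lambda>b. g (wt k b)) =
      (\<Sum>c\<in>UNIV. pmf (bernoulli_pmf q) c *\<^sub>R measure_pmf.expectation (P c) (\<lambda>b. g (wt k b)))"
      unfolding D_def by (intro pmf_expectation_bind) auto
    then show ?thesis
      using q by (simp add: EP UNIV_bool W_def)
  qed
  have "real k * mu D = q * (2 * real s - real k) + (1 - q) * (2 * real 0 - real k)"
    by (simp only: mu_eq_expectation_wt[OF D] E[of "\<lambda>w. 2 * real w - real k"])
  also have "\<dots> = 0"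
    by (simp add: q_def s_def k field_simps)
  finally have "mu D = 0" using k by simp
  moreover have "gamma {s} k D = q"
  proof -
    have "gamma {s} k D = measure_pmf.expectation D (\<lambda>b. if wt k b \<in> {s} then 1 else 0)"
      by (simp add: gamma_eq_expectation[OF sym_dists_support[OF D]] sym_pred_def[abs_def])
    also have "\<dots> = q"
      \<comment> \<open>The term at weight 0 vanishes because \<open>s\<close> is positive.\<close>
      by (subst E) (simp add: s_def)
    finally show ?thesis .
  qed
  ultimately show ?thesis using D by (auto simp: s_def q_def)
qed

section \<open>The two bounds on \<open>alpha\<close> and the limit\<close>

lemma alpha_ge_rho: "ereal (rho k (sym_pred S k)) \<le> alpha S k"
  unfolding alpha_def
proof (rule Inf_greatest)
  fix r assume "r \<in> {dist_ratio S k DN DY |DN DY.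
    DN \<in> sym_dists k \<and> DY \<in> sym_dists k \<and> mu DN = mu DY}"
  then obtain DN DY where r: "r = dist_ratio S k DN DY" and DN: "set_pmf DN \<subseteq> cube k"
    using sym_dists_support by blast
  have \<gamma>: "0 \<le> gamma S k DY" "gamma S k DY \<le> 1"
    by (auto simp: gamma_def lam_bounds)
  have \<rho>: "0 \<le> rho k (sym_pred S k)" by (simp add: rho_def)
  show "ereal (rho k (sym_pred S k)) \<le> r"
  proof (cases "gamma S k DY = 0")
    case False
    have "rho k (sym_pred S k) * gamma S k DY \<le> rho k (sym_pred S k) * 1"
      using \<rho> \<gamma> by (intro mult_left_mono) auto
    also have "\<dots> \<le> beta S k DN" using beta_ge_rho[OF DN] by simp
    finally show ?thesis using False \<gamma> by (simp add: r dist_ratio_def field_simps)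
  qed (simp add: r dist_ratio_def)
qed

lemma alpha_le:
  assumes k: "k = 2 * m + 1"
  shows "alpha {m + 1} k \<le> ereal (rho k (sym_pred {m + 1} k) * (real (k + 1) / real k))"
proof -
  obtain D where D: "D \<in> sym_dists k" "mu D = 0" "gamma {m + 1} k D = real k / real (k + 1)"
    using exists_large_gamma[OF k] by blast
  have "alpha {m + 1} k \<le> dist_ratio {m + 1} k (pmf_of_set (cube k)) D"
  proof -
    have "mu (pmf_of_set (cube k)) = mu D"
      using D(2) k by (simp add: mu_uniform)
    with D(1) uniform_sym_dists show ?thesis
      unfolding alpha_def by (intro Inf_lower) blast
  qed
  also have "\<dots> = ereal (rho k (sym_pred {m + 1} k) * (real (k + 1) / real k))"
    using D k by (simp add: dist_ratio_def beta_uniform)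
  finally show ?thesis .
qed

lemma alpha_div_rho_bounds:
  assumes "odd k"
  defines "s \<equiv> (k + 1) div 2"
  shows "1 \<le> alpha {s} k / ereal (rho k (sym_pred {s} k))"
    and "alpha {s} k / ereal (rho k (sym_pred {s} k)) \<le> ereal (1 + 1 / real k)"
proof -
  obtain m where k: "k = 2 * m + 1" using assms(1) by (auto elim: oddE)
  have s: "s = m + 1" using k by (simp add: s_def)
  define \<rho> where "\<rho> = rho k (sym_pred {s} k)"
  have pos: "\<rho> > 0" unfolding \<rho>_def using k s by (intro rho_pos) auto
  have lo: "ereal \<rho> \<le> alpha {s} k" unfolding \<rho>_def by (rule alpha_ge_rho)
  have hi: "alpha {s} k \<le> ereal (\<rho> * (real (k + 1) / real k))"
    unfolding \<rho>_def s by (rule alpha_le[OF k])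
  \<comment> \<open>Lying between two reals, \<open>alpha\<close> is finite, and the division can be
    done in the reals.\<close>
  obtain r where r: "alpha {s} k = ereal r"
    using lo hi by (cases "alpha {s} k") auto
  have "\<rho> \<le> r" "r \<le> \<rho> * (real (k + 1) / real k)" using lo hi r by auto
  moreover have "real (k + 1) / real k = 1 + 1 / real k" using k by (simp add: field_simps)
  ultimately have "1 \<le> r / \<rho>" "r / \<rho> \<le> 1 + 1 / real k"
    using pos by (auto simp only: pos_le_divide_eq pos_divide_le_eq mult.commute mult_1)
  then show "1 \<le> alpha {s} k / ereal (rho k (sym_pred {s} k))"
    "alpha {s} k / ereal (rho k (sym_pred {s} k)) \<le> ereal (1 + 1 / real k)"
    using pos r by (simp_all add: \<rho>_def[symmetric])
qed

theorem theorem1p6: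
  shows "((\<lambda>k::nat. alpha {(k + 1) div 2} k / ereal (rho k (sym_pred {(k + 1) div 2} k)))
           \<longlongrightarrow> (1::ereal)) (inf sequentially (principal {k. odd k}))"
proof (rule tendsto_sandwich[OF _ _ tendsto_const])
  have "(\<lambda>k. 1 + 1 / real k) \<longlonglongrightarrow> 1 + 0"
    by (intro tendsto_intros lim_1_over_n)
  then have "(\<lambda>k. ereal (1 + 1 / real k)) \<longlonglongrightarrow> 1"
    by (simp add: one_ereal_def)
  then show "((\<lambda>k. ereal (1 + 1 / real k)) \<longlongrightarrow> 1) (inf sequentially (principal {k. odd k}))"
    \<comment> \<open>Restricting to odd \<open>k\<close> gives a finer filter, so the limit along
      all \<open>k\<close> carries over.\<close>
    by (rule tendsto_mono[rotated]) simp
qed (use alpha_div_rho_bounds in \<open>simp_all add: eventually_inf_principal del: add_2_eq_Suc'\<close>)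

end
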